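(* Let $X$ be a finite set, and let $d\geq 1$ and $r\geq 1$ be integers. Suppose $\mathcal{F}\subset \binom{X}{r}^d$ is a $d$-dimensional $r$-uniform family of size \[ |\mathcal{F}|=\binom{x}{r}^d, \] where $x\geq r$ is a real number. Then \[ |\partial \mathcal{F}|\geq \binom{x}{r-1}^d. \] Moreover, equality holds only if $\mathcal{F}$ is of the form $\binom{Y_1}{r}\times \dotsb\times \binom{Y_d}{r}$ for some sets $Y_1,\dotsc,Y_d\subset X$.
   Context: For a set $X$, $\binom{X}{r}$ denotes the family of all $r$-element subsets of $X$. A $d$-dimensional $r$-uniform family is a subset of $\binom{X}{r}^d$, i.e. a collection of $d$-tuples of $r$-element subsets of $X$. The shadow of $\mathcal{F}\subset\binom{X}{r}^d$ is \[ \partial\mathcal{F}=\{(S_1\setminus\{x_1\},\dotsc,S_d\setminus\{x_d\}) : (S_1,\dotsc,S_d)\in\mathcal{F},\ x_i\in S_i \text{ for } i=1,\dotsc,d\}\subset \binom{X}{r-1}^d. \] For a real number $x$ and a nonnegative integer $k$, $\binom{x}{k}=x(x-1)\dotsb(x-k+1)/k!$.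
   Formalization: The equality clause is stated only for r ≥ 2 or d = 1; for r = 1, d ≥ 2 it is false, since every nonempty family has shadow of size 1, e.g. F = {({0},{0}),({1},{1})} with x = √2 attains equality but is not a product. *)

theory Defs
  imports Complex_Main "HOL-Library.FuncSet" "HOL-Library.Ramsey"
begin

(* A d-tuple is an extensional function on {1..d}; the family of r-element subsets of X is
   the library's nsets X r. *)

definition uniform_family :: "nat \<Rightarrow> nat \<Rightarrow> 'a set \<Rightarrow> (nat \<Rightarrow> 'a set) set \<Rightarrow> bool" where
  "uniform_family d r X F \<longleftrightarrow> F \<subseteq> (\<Pi>\<^sub>E i\<in>{1..d}. nsets X r)"

definition shadow :: "nat \<Rightarrow> (nat \<Rightarrow> 'a set) set \<Rightarrow> (nat \<Rightarrow> 'a set) set" where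
  "shadow d F = {(\<lambda>i\<in>{1..d}. S i - {e i}) | S e. S \<in> F \<and> (\<forall>i\<in>{1..d}. e i \<in> S i)}"

lemma uniform_family_shadow:
  assumes "uniform_family d r X F"
  shows "uniform_family d (r - 1) X (shadow d F)"
  using assms unfolding uniform_family_def shadow_def nsets_def by (fastforce simp: PiE_iff)

end

theory Submission
  imports Defs "HOL-Analysis.Convex"
begin

text \<open>The bound \<open>|\<partial>F| \<ge> (x gchoose k)\<close> for \<open>|F| = (x gchoose Suc k)\<close> is a curve that is strictly convex in
  logarithmic coordinates. Replacing it by its tangent at the given \<open>x\<close> yields a power bound
  \<open>|\<partial>F| \<ge> c |F|\<^sup>\<alpha>\<close> with \<open>0 < \<alpha> < 1\<close>, and power bounds multiply over products by Minkowski's inequality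
  in \<open>\<ell>\<^sup>1\<^sup>/\<^sup>\<alpha>\<close>: take the shadow in one coordinate fibrewise, then in the others. Equality in Minkowski
  forces a rectangle, which gives the product structure. The one-dimensional bound is proved by
  Keevash's argument, counting for each vertex the \<open>(k+1)\<close>-sets all of whose \<open>k\<close>-subsets lie in \<open>\<partial>F\<close>.\<close>

section \<open>Generalised binomial coefficients\<close>

lemma gbinomial_pos:
  fixes x :: real
  assumes "real k < x + 1"
  shows "0 < x gchoose k"
  unfolding gbinomial_prod_rev using assms
  by (intro divide_pos_pos prod_pos) auto

lemma gbinomial_strict_mono:
  fixes x y :: real
  assumes "0 < k" "real k < x + 1" "x < y"
  shows "x gchoose k < y gchoose k"
  unfolding gbinomial_prod_rev using assms
  by (intro divide_strict_right_mono prod_mono_strict) auto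

text \<open>The coefficient is strictly increasing where all factors \<open>x - i\<close> with
  \<open>i < k\<close> are positive, that is for \<open>x > k - 1\<close>. The range has to reach
  below \<open>k\<close>: in \<open>kruskal_katona_lovasz\<close> it is applied to
  \<open>Suc k\<close> with \<open>y\<close> only known to exceed \<open>k\<close>.\<close>

lemma gbinomial_le_iff:
  fixes x y :: real
  assumes "0 < k" "real k < x + 1" "real k < y + 1"
  shows "x gchoose k \<le> y gchoose k \<longleftrightarrow> x \<le> y"
  using gbinomial_strict_mono[of k x y] gbinomial_strict_mono[of k y x] assms
  by (cases x y rule: linorder_cases) auto

lemma binomial_add_right_gt: "0 < k \<Longrightarrow> n < (n + k) choose k"
proof (induction n)
  case (Suc n)
  have "0 < (n + k) choose (k - 1)"
    by simp
  moreover have "(Suc n + k) choose k = ((n + k) choose (k - 1)) + ((n + k) choose k)"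
    using Suc.prems by (simp add: choose_reduce_nat)
  ultimately show ?case
    using Suc by linarith
qed simp

text \<open>Intermediate value theorem between \<open>k\<close>, where the coefficient is 1, and
  \<open>n + k\<close>, where it exceeds \<open>n\<close>. This lets the size of any nonempty finite
  family be written as a binomial coefficient with real upper argument.\<close>

lemma gbinomial_eq_of_nat_ex:
  fixes n k :: nat
  assumes "0 < k" "0 < n"
  shows "\<exists>y::real. real k \<le> y \<and> y gchoose k = real n"
proof -
  have "continuous_on {real k..real (n + k)} (\<lambda>y. y gchoose k)"
    unfolding gbinomial_prod_rev by (intro continuous_intros) auto
  moreover have "real k gchoose k \<le> real n"
    using assms by (simp flip: binomial_gbinomial)
  moreover have "real n \<le> real (n + k) gchoose k"
    using binomial_add_right_gt[OF assms(1), of n]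
    unfolding binomial_gbinomial[symmetric] of_nat_le_iff by linarith
  ultimately show ?thesis
    using IVT'[of "\<lambda>y. y gchoose k" "real k" "real n" "real (n + k)"] by auto
qed

lemma ln_gbinomial:
  fixes x :: real
  assumes "real k < x + 1"
  shows "ln (x gchoose k) = (\<Sum>i<k. ln (x - real i)) - ln (fact k)"
proof -
  have "ln (\<Prod>i=0..<k. x - real i) = (\<Sum>i<k. ln (x - real i))"
    using assms by (subst ln_prod) (auto simp: atLeast0LessThan)
  moreover have "0 < (\<Prod>i=0..<k. x - real i)"
    using assms by (intro prod_pos) auto
  ultimately show ?thesis
    unfolding gbinomial_prod_rev by (metis ln_divide_pos fact_gt_zero)
qed

text \<open>In logarithmic coordinates \<open>(x gchoose Suc k, x gchoose k)\<close> traces a strictly convex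
  curve; \<open>\<alpha>\<close> is the slope of its tangent at \<open>x\<close>.\<close>

lemma gbinomial_log_tangent:
  fixes x :: real
  assumes k: "0 < k" and x: "real k < x"
  obtains \<alpha> where "0 < \<alpha>" "\<alpha> < 1"
    "\<And>y. real k < y \<Longrightarrow> y \<noteq> x \<Longrightarrow>
      ln (x gchoose k) - \<alpha> * ln (x gchoose Suc k) < ln (y gchoose k) - \<alpha> * ln (y gchoose Suc k)"
proof
  \<comment> \<open>\<open>Q y / (y - k)\<close> is the derivative of
    \<open>ln (y gchoose k)\<close>, and passing to \<open>Suc k\<close> adds
    \<open>1 / (y - k)\<close>. The slope of the curve at \<open>y\<close> is therefore
    \<open>Q y / (1 + Q y)\<close>, and \<open>\<alpha>\<close> is its value at
    \<open>x\<close>.\<close>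
  define Q where "Q = (\<lambda>y. \<Sum>i<k. (y - real k) / (y - real i))"
  define \<alpha> where "\<alpha> = Q x / (1 + Q x)"
  define h where "h = (\<lambda>y. ln (y gchoose k) - \<alpha> * ln (y gchoose Suc k))"
  have Qpos: "0 < Q y" if "real k < y" for y
    unfolding Q_def using that k by (intro sum_pos) auto
  \<comment> \<open>Each summand equals \<open>1 - (k - i) / (y - i)\<close>, which increases with
    \<open>y\<close> because \<open>i < k\<close>.\<close>
  have Qmono: "Q y < Q z" if "real k < y" "y < z" for y z
    unfolding Q_def
  proof (rule sum_strict_mono)
    fix i assume "i \<in> {..<k}"
    then have "real i < real k" by simp
    moreover from this that have "(z - y) * real i < (z - y) * real k" by simp
    ultimately show "(y - real k) / (y - real i) < (z - real k) / (z - real i)"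
      using that by (simp add: divide_simps algebra_simps)
  qed (use k in auto)
  show "0 < \<alpha>" "\<alpha> < 1"
    using Qpos[OF x] by (auto simp: \<alpha>_def)
  have h_eq: "h y = (1 - \<alpha>) * (\<Sum>i<k. ln (y - real i)) - \<alpha> * ln (y - real k)
      - ln (fact k) + \<alpha> * ln (fact (Suc k))" if "real k < y" for y
    unfolding h_def using that by (simp add: ln_gbinomial algebra_simps)
  \<comment> \<open>The sign of \<open>h'\<close> is that of \<open>Q y - Q x\<close>, so
    \<open>h\<close> falls before \<open>x\<close> and rises after it: \<open>x\<close> is the
    unique minimum.\<close>
  define h' where "h' = (\<lambda>y. (Q y - Q x) / ((y - real k) * (1 + Q x)))"
  have deriv: "(h has_real_derivative h' y) (at y)" if y: "real k < y" for y
  proof -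
    have "((\<lambda>y. (1 - \<alpha>) * (\<Sum>i<k. ln (y - real i)) - \<alpha> * ln (y - real k)
      - ln (fact k) + \<alpha> * ln (fact (Suc k))) has_real_derivative
        (1 - \<alpha>) * (\<Sum>i<k. 1 / (y - real i)) - \<alpha> / (y - real k)) (at y)"
      using y by (auto intro!: derivative_eq_intros simp: divide_simps)
    also have "(\<Sum>i<k. 1 / (y - real i)) = Q y / (y - real k)"
      using y by (simp add: Q_def sum_divide_distrib)
    also have "(1 - \<alpha>) * (Q y / (y - real k)) - \<alpha> / (y - real k) = h' y"
      using y Qpos[OF x] by (simp add: h'_def \<alpha>_def divide_simps)
    finally show ?thesis
      by (rule has_field_derivative_transform_within_open[where S="{real k<..}"])
        (use y h_eq in auto)
  qed
  fix y assume y: "real k < y" "y \<noteq> x"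
  have "h x < h y"
  proof (cases "x < y")
    case True
    have "0 < h' z" if "x < z" for z
      using Qmono[OF x that] Qpos[OF x] x that by (simp add: h'_def)
    moreover have "continuous_on {x..y} h"
      using deriv x by (intro DERIV_continuous_on[where D=h'])
        (auto intro: has_field_derivative_at_within)
    ultimately show ?thesis
      using deriv x by (intro DERIV_pos_imp_increasing_open[OF True]) (meson less_trans, auto)
  next
    case False
    with y have "y < x" by simp
    have "h' z < 0" if "y < z" "z < x" for z
      using Qmono[of z x] Qpos[OF x] y that by (simp add: h'_def divide_neg_pos)
    moreover have "continuous_on {y..x} h"
      using deriv y by (intro DERIV_continuous_on[where D=h'])
        (auto intro: has_field_derivative_at_within)
    ultimately show ?thesis
      using deriv y by (intro DERIV_neg_imp_decreasing_open[OF \<open>y < x\<close>]) (meson less_trans, auto)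
  qed
  then show "ln (x gchoose k) - \<alpha> * ln (x gchoose Suc k) < ln (y gchoose k) - \<alpha> * ln (y gchoose Suc k)"
    by (simp add: h_def)
qed

section \<open>Tensorisation of power bounds\<close>

text \<open>Concavity of \<open>t powr (1 - \<alpha>)\<close>: Young's inequality compares each
  \<open>f a\<close> with the mean \<open>M\<close>, and summing makes both terms on the right
  multiples of \<open>M\<close>.\<close>

lemma sum_powr_le_card_powr:
  fixes f :: "'a \<Rightarrow> real"
  assumes "finite S" "S \<noteq> {}" "\<And>a. a \<in> S \<Longrightarrow> 0 < f a" "0 < \<alpha>" "\<alpha> < 1"
  shows "(\<Sum>a\<in>S. f a powr (1 - \<alpha>)) \<le> real (card S) powr \<alpha> * (\<Sum>a\<in>S. f a) powr (1 - \<alpha>)"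
proof -
  define M where "M = (\<Sum>a\<in>S. f a) / card S"
  have card: "0 < real (card S)"
    using assms by (simp add: card_gt_0_iff)
  have sum: "(\<Sum>a\<in>S. f a) = M * card S"
    using card by (simp add: M_def)
  have M: "0 < M"
    unfolding M_def using assms card by (intro divide_pos_pos sum_pos)
  have "M powr \<alpha> * (\<Sum>a\<in>S. f a powr (1 - \<alpha>)) = (\<Sum>a\<in>S. M powr \<alpha> * f a powr (1 - \<alpha>))"
    by (simp add: sum_distrib_left)
  also have "\<dots> \<le> (\<Sum>a\<in>S. \<alpha> * M + (1 - \<alpha>) * f a)"
    using assms M by (intro sum_mono Youngs_inequality_0) auto
  also have "\<dots> = card S * M"
    unfolding sum.distrib sum_distrib_left[symmetric] sum by (simp add: algebra_simps)
  also have "\<dots> = M powr \<alpha> * (card S powr \<alpha> * (M * card S) powr (1 - \<alpha>))"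
    using M card by (simp add: powr_mult powr_diff)
  finally show ?thesis
    unfolding sum using M by simp
qed

text \<open>Minkowski's inequality in \<open>\<ell>\<^sup>p\<close>, \<open>p = 1 / \<alpha>\<close>, for the indicator functions of the columns of \<open>H\<close>.\<close>

lemma Minkowski_relation:
  fixes H :: "('a \<times> 'b) set"
  assumes "finite H" "H \<noteq> {}" "0 < \<alpha>" "\<alpha> < 1"
  defines "K \<equiv> (\<Sum>a\<in>Domain H. real (card (H `` {a})) powr (1 / \<alpha>))"
  shows "K powr \<alpha> \<le> (\<Sum>b\<in>Range H. real (card (H\<inverse> `` {b})) powr \<alpha>)"
    and "K powr \<alpha> = (\<Sum>b\<in>Range H. real (card (H\<inverse> `` {b})) powr \<alpha>) \<Longrightarrow> H = Domain H \<times> Range H"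
proof -
  define n where "n = (\<lambda>a. real (card (H `` {a})))"
  \<comment> \<open>The part of \<open>K\<close> carried by the column over \<open>b\<close>. It
    falls short of \<open>K\<close> as soon as that column misses a point of the domain, which is
    the source of the equality case.\<close>
  define K' where "K' = (\<lambda>b. \<Sum>a\<in>H\<inverse> `` {b}. n a powr (1 / \<alpha>))"
  have K_eq: "K = (\<Sum>a\<in>Domain H. n a powr (1 / \<alpha>))"
    by (simp add: K_def n_def)
  have fin: "finite (Domain H)" "finite (Range H)"
    using assms by (auto simp: finite_Domain finite_Range)
  have fin1: "finite (H `` {a})" for a
    using fin(2) by (rule finite_subset[rotated]) auto
  have fin2: "finite (H\<inverse> `` {b})" for b
    using fin(1) by (rule finite_subset[rotated]) auto
  have npos: "0 < n a" if "a \<in> Domain H" for a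
    using that fin1 by (auto simp: n_def card_gt_0_iff)
  have cpos: "0 < real (card (H\<inverse> `` {b}))" if "b \<in> Range H" for b
    using that fin2 by (auto simp: card_gt_0_iff)
  have Kpos: "0 < K"
    unfolding K_eq using fin assms(2) npos by (intro sum_pos) fastforce+
  have K'_le: "K' b \<le> K" for b
    unfolding K'_def K_eq using fin by (intro sum_mono2) auto
  have K'_less: "K' b < K" if "a \<in> Domain H" "(a, b) \<notin> H" for a b
    unfolding K'_def K_eq using fin that npos[OF that(1)]
    by (intro sum_strict_mono2[of _ _ a]) auto
  have "K = (\<Sum>a\<in>Domain H. \<Sum>b\<in>H `` {a}. n a powr (1 / \<alpha> - 1))"
    unfolding K_def
  proof (rule sum.cong[OF refl])
    fix a assume "a \<in> Domain H"
    then show "real (card (H `` {a})) powr (1 / \<alpha>) = (\<Sum>b\<in>H `` {a}. n a powr (1 / \<alpha> - 1))"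
      using npos[of a] by (simp add: powr_diff n_def)
  qed
  also have "\<dots> = (\<Sum>a\<in>Domain H. \<Sum>b\<in>{b \<in> Range H. (a, b) \<in> H}. n a powr (1 / \<alpha> - 1))"
    by (intro sum.cong) auto
  also have "\<dots> = (\<Sum>b\<in>Range H. \<Sum>a\<in>{a \<in> Domain H. (a, b) \<in> H}. n a powr (1 / \<alpha> - 1))"
    using fin by (rule sum.swap_restrict)
  also have "\<dots> = (\<Sum>b\<in>Range H. \<Sum>a\<in>H\<inverse> `` {b}. (n a powr (1 / \<alpha>)) powr (1 - \<alpha>))"
    using assms by (intro sum.cong) (auto simp: powr_powr field_simps)
  also have "\<dots> \<le> (\<Sum>b\<in>Range H. real (card (H\<inverse> `` {b})) powr \<alpha> * K' b powr (1 - \<alpha>))"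
    unfolding K'_def
  proof (rule sum_mono)
    fix b assume "b \<in> Range H"
    then show "(\<Sum>a\<in>H\<inverse> `` {b}. (n a powr (1 / \<alpha>)) powr (1 - \<alpha>))
      \<le> real (card (H\<inverse> `` {b})) powr \<alpha> * (\<Sum>a\<in>H\<inverse> `` {b}. n a powr (1 / \<alpha>)) powr (1 - \<alpha>)"
      using fin2 npos assms(3,4) by (intro sum_powr_le_card_powr) fastforce+
  qed
  finally have main: "K \<le> (\<Sum>b\<in>Range H. real (card (H\<inverse> `` {b})) powr \<alpha> * K' b powr (1 - \<alpha>))" .
  have K'_nonneg: "0 \<le> K' b" for b
    unfolding K'_def by (intro sum_nonneg) auto
  have term_le: "real (card (H\<inverse> `` {b})) powr \<alpha> * K' b powr (1 - \<alpha>)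
      \<le> real (card (H\<inverse> `` {b})) powr \<alpha> * K powr (1 - \<alpha>)" for b
    using assms(4) K'_le K'_nonneg by (intro mult_left_mono powr_mono2) auto
  \<comment> \<open>Bounding each \<open>K' b\<close> by \<open>K\<close> leaves a common factor
    \<open>K powr (1 - \<alpha>)\<close>, which is cancelled against the left-hand side.\<close>
  have K_split: "K = K powr \<alpha> * K powr (1 - \<alpha>)"
    using Kpos by (simp add: powr_diff)
  define R where "R = (\<Sum>b\<in>Range H. real (card (H\<inverse> `` {b})) powr \<alpha>)"
  have "(\<Sum>b\<in>Range H. real (card (H\<inverse> `` {b})) powr \<alpha> * K' b powr (1 - \<alpha>)) \<le> R * K powr (1 - \<alpha>)"
    unfolding R_def sum_distrib_right by (intro sum_mono term_le)
  with main K_split have "K powr \<alpha> * K powr (1 - \<alpha>) \<le> R * K powr (1 - \<alpha>)"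
    by linarith
  then show "K powr \<alpha> \<le> (\<Sum>b\<in>Range H. real (card (H\<inverse> `` {b})) powr \<alpha>)"
    unfolding R_def[symmetric] using Kpos by simp
  assume eq: "K powr \<alpha> = (\<Sum>b\<in>Range H. real (card (H\<inverse> `` {b})) powr \<alpha>)"
  have "(a, b) \<in> H" if "a \<in> Domain H" "b \<in> Range H" for a b
  proof (rule ccontr)
    assume "(a, b) \<notin> H"
    with that have "K' b < K"
      by (intro K'_less)
    then have "K' b powr (1 - \<alpha>) < K powr (1 - \<alpha>)"
      using assms(4) K'_nonneg by (intro powr_less_mono2) auto
    then have "real (card (H\<inverse> `` {b})) powr \<alpha> * K' b powr (1 - \<alpha>)
      < real (card (H\<inverse> `` {b})) powr \<alpha> * K powr (1 - \<alpha>)"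
      using cpos[OF that(2)] by simp
    then have "(\<Sum>b\<in>Range H. real (card (H\<inverse> `` {b})) powr \<alpha> * K' b powr (1 - \<alpha>)) < R * K powr (1 - \<alpha>)"
      unfolding R_def sum_distrib_right using fin that(2) term_le
      by (intro sum_strict_mono_ex1) blast+
    with main K_split eq show False
      unfolding R_def by simp
  qed
  then show "H = Domain H \<times> Range H"
    by auto
qed

definition rel_times :: "('a \<times> 'c) set \<Rightarrow> ('b \<times> 'd) set \<Rightarrow> (('a \<times> 'b) \<times> ('c \<times> 'd)) set" where
  "rel_times R1 R2 = {((a, b), (a', b')). (a, a') \<in> R1 \<and> (b, b') \<in> R2}"

text \<open>First \<open>R2\<close> is applied inside each fibre of \<open>F\<close> over the first
  coordinate, giving \<open>H\<close>; then \<open>R1\<close> inside each fibre of \<open>H\<close>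
  over the second. The two power bounds are joined by Minkowski's inequality for \<open>H\<close>.
  Equality must hold in all three steps, and the one in Minkowski makes all fibres of
  \<open>H\<close> equal.\<close>

lemma card_rel_times_Image_ge:
  fixes R1 :: "('a \<times> 'c) set" and R2 :: "('b \<times> 'd) set" and F :: "('a \<times> 'b) set"
  assumes \<alpha>: "0 < \<alpha>" "\<alpha> < 1" and c: "0 < c1" "0 < c2"
    and fin: "finite F" "\<And>a. a \<in> A \<Longrightarrow> finite (R1 `` {a})"
      "\<And>b. b \<in> B \<Longrightarrow> finite (R2 `` {b})"
    and F: "F \<subseteq> A \<times> B" "F \<noteq> {}"
    and R1: "\<And>S. S \<subseteq> A \<Longrightarrow> S \<noteq> {} \<Longrightarrow> finite S \<Longrightarrow> c1 * card S powr \<alpha> \<le> card (R1 `` S)"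
    and R2: "\<And>S. S \<subseteq> B \<Longrightarrow> S \<noteq> {} \<Longrightarrow> finite S \<Longrightarrow> c2 * card S powr \<alpha> \<le> card (R2 `` S)"
  shows "c1 * c2 * card F powr \<alpha> \<le> card (rel_times R1 R2 `` F)"
    and "c1 * c2 * card F powr \<alpha> = card (rel_times R1 R2 `` F) \<Longrightarrow>
      c1 * card (Domain F) powr \<alpha> = card (R1 `` Domain F) \<and>
      (\<forall>a\<in>Domain F. c2 * card (F `` {a}) powr \<alpha> = card (R2 `` (F `` {a})) \<and>
         R2 `` (F `` {a}) = R2 `` Range F)"
proof -
  define H where "H = F O R2"
  have H_Image: "H `` {a} = R2 `` (F `` {a})" for a
    by (auto simp: H_def)
  have finF1: "finite (F `` {a})" for a
    using finite_Range[OF fin(1)] by (rule finite_subset[rotated]) auto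
  have finF2: "finite (Domain F)"
    using fin(1) by (rule finite_Domain)
  have finR1: "finite (R1 `` S)" if "finite S" "S \<subseteq> A" for S
    by (subst Image_eq_UN) (use fin(2) that in auto)
  have finR2: "finite (R2 `` S)" if "finite S" "S \<subseteq> B" for S
    by (subst Image_eq_UN) (use fin(3) that in auto)
  have pos2: "0 < c2 * card (F `` {a}) powr \<alpha>" if "a \<in> Domain F" for a
    using that finF1 c by (intro mult_pos_pos) auto
  have le2: "c2 * card (F `` {a}) powr \<alpha> \<le> card (H `` {a})" if "a \<in> Domain F" for a
    unfolding H_Image using that F finF1 by (intro R2) auto
  \<comment> \<open>No first coordinate is lost: the power bound is positive on a nonempty fibre, so
    its image under \<open>R2\<close> is nonempty.\<close>
  have DomH: "Domain H = Domain F"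
  proof
    show "Domain F \<subseteq> Domain H"
    proof
      fix a assume a: "a \<in> Domain F"
      then have "card (H `` {a}) \<noteq> 0"
        using le2[OF a] pos2[OF a] by linarith
      then have "H `` {a} \<noteq> {}"
        by (metis card.empty)
      then show "a \<in> Domain H"
        by blast
    qed
  qed (auto simp: H_def)
  have RanH: "Range H = R2 `` Range F"
    by (auto simp: H_def)
  have finH: "finite H"
  proof (rule finite_subset)
    show "H \<subseteq> Domain F \<times> R2 `` Range F"
      by (auto simp: H_def)
    show "finite (Domain F \<times> R2 `` Range F)"
      using finF2 finR2[of "Range F"] finite_Range[OF fin(1)] F(1) by auto
  qed
  have H_ne: "H \<noteq> {}"
    using F(2) DomH by auto
  have finH2: "finite (H\<inverse> `` {b})" for b
    using finite_Domain[OF finH] by (rule finite_subset[rotated]) auto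
  have le1: "c1 * card (H\<inverse> `` {b}) powr \<alpha> \<le> card (R1 `` (H\<inverse> `` {b}))" if "b \<in> Range H" for b
    using that F finH2 by (intro R1) (auto simp: H_def)
  define K where "K = (\<Sum>a\<in>Domain H. real (card (H `` {a})) powr (1 / \<alpha>))"
  define T where "T = (\<Sum>b\<in>Range H. real (card (H\<inverse> `` {b})) powr \<alpha>)"
  note Mink = Minkowski_relation[OF finH H_ne \<alpha>, folded K_def T_def]
  \<comment> \<open>The image is fibred over its second coordinate, where the fibre over
    \<open>b\<close> is the \<open>R1\<close>-image of a column of \<open>H\<close>.\<close>
  have "rel_times R1 R2 `` F = (\<lambda>(b, a). (a, b)) ` (SIGMA b:Range H. R1 `` (H\<inverse> `` {b}))"
    by (force simp: rel_times_def H_def)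
  then have "card (rel_times R1 R2 `` F) = card (SIGMA b:Range H. R1 `` (H\<inverse> `` {b}))"
    by (simp add: card_image inj_on_def)
  also have "\<dots> = (\<Sum>b\<in>Range H. card (R1 `` (H\<inverse> `` {b})))"
    using finH2 finite_Range[OF finH] DomH F(1) by (intro card_SigmaI ballI finR1) auto
  finally have card_eq: "real (card (rel_times R1 R2 `` F)) = (\<Sum>b\<in>Range H. real (card (R1 `` (H\<inverse> `` {b}))))"
    by simp
  have s1: "c1 * T \<le> card (rel_times R1 R2 `` F)"
    unfolding card_eq T_def sum_distrib_left by (intro sum_mono le1)
  have s2: "c1 * K powr \<alpha> \<le> c1 * T"
    using Mink(1) c by simp
  have "card F = card (SIGMA a:Domain F. F `` {a})"
    by (rule arg_cong[where f=card]) auto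
  also have "\<dots> = (\<Sum>a\<in>Domain F. card (F `` {a}))"
    using finF1 finF2 by (intro card_SigmaI) auto
  finally have "real (card F) = (\<Sum>a\<in>Domain F. real (card (F `` {a})))"
    by simp
  then have cardF: "c2 powr (1 / \<alpha>) * real (card F) = (\<Sum>a\<in>Domain F. (c2 * card (F `` {a}) powr \<alpha>) powr (1 / \<alpha>))"
    using \<alpha> c by (simp add: sum_distrib_left powr_mult powr_powr)
  have s3': "c2 powr (1 / \<alpha>) * real (card F) \<le> K"
    unfolding cardF K_def DomH using \<alpha> pos2 le2 by (intro sum_mono powr_mono2) (auto simp: less_imp_le)
  have c2F: "c1 * c2 * card F powr \<alpha> = c1 * (c2 powr (1 / \<alpha>) * real (card F)) powr \<alpha>"
    using \<alpha> c by (simp add: powr_mult powr_powr)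
  have s3: "c1 * c2 * card F powr \<alpha> \<le> c1 * K powr \<alpha>"
    unfolding c2F using s3' \<alpha> c by (intro mult_left_mono powr_mono2) auto
  show "c1 * c2 * card F powr \<alpha> \<le> card (rel_times R1 R2 `` F)"
    using s1 s2 s3 by linarith
  assume eq: "c1 * c2 * card F powr \<alpha> = card (rel_times R1 R2 `` F)"
  \<comment> \<open>The chain of \<open>s3\<close>, \<open>s2\<close> and \<open>s1\<close> now has
    equal ends. Its middle link makes \<open>H\<close> a rectangle, while \<open>s1\<close> and
    \<open>s3\<close> are termwise sums and give \<open>eq1\<close> and \<open>eq2\<close>.\<close>
  have "c1 * K powr \<alpha> = c1 * T"
    using s1 s2 s3 eq by linarith
  then have "K powr \<alpha> = T"
    using c by simp
  then have H_prod: "H = Domain F \<times> (R2 `` Range F)"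
    using Mink(2) DomH RanH by simp
  have eq1: "c1 * card (H\<inverse> `` {b}) powr \<alpha> = card (R1 `` (H\<inverse> `` {b}))" if "b \<in> Range H" for b
  proof (rule ccontr)
    assume "c1 * card (H\<inverse> `` {b}) powr \<alpha> \<noteq> card (R1 `` (H\<inverse> `` {b}))"
    with le1[OF that] have "c1 * card (H\<inverse> `` {b}) powr \<alpha> < card (R1 `` (H\<inverse> `` {b}))"
      by simp
    then have "c1 * T < card (rel_times R1 R2 `` F)"
      unfolding card_eq T_def sum_distrib_left using that le1 finite_Range[OF finH]
      by (intro sum_strict_mono_ex1) blast+
    with s2 s3 eq show False by linarith
  qed
  have eq2: "c2 * card (F `` {a}) powr \<alpha> = card (H `` {a})" if "a \<in> Domain F" for a
  proof (rule ccontr)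
    assume "c2 * card (F `` {a}) powr \<alpha> \<noteq> card (H `` {a})"
    with le2[OF that] have "c2 * card (F `` {a}) powr \<alpha> < card (H `` {a})"
      by simp
    then have "(c2 * card (F `` {a}) powr \<alpha>) powr (1 / \<alpha>) < card (H `` {a}) powr (1 / \<alpha>)"
      using pos2[OF that] \<alpha> by (intro powr_less_mono2) auto
    moreover have "(c2 * card (F `` {a'}) powr \<alpha>) powr (1 / \<alpha>) \<le> card (H `` {a'}) powr (1 / \<alpha>)"
      if "a' \<in> Domain F" for a'
      using \<alpha> pos2[OF that] le2[OF that] by (intro powr_mono2) auto
    ultimately have "c2 powr (1 / \<alpha>) * real (card F) < K"
      unfolding cardF K_def DomH using that finF2 by (intro sum_strict_mono_ex1) blast+
    then have "c1 * c2 * card F powr \<alpha> < c1 * K powr \<alpha>"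
      unfolding c2F using \<alpha> c by (intro mult_strict_left_mono powr_less_mono2) auto
    with s1 s2 eq show False by linarith
  qed
  \<comment> \<open>As \<open>H\<close> is a rectangle, any single \<open>b\<close> has the whole
    \<open>Domain F\<close> as its column.\<close>
  obtain b where b: "b \<in> Range H"
    using H_ne by auto
  have "H\<inverse> `` {b} = Domain F"
    using b unfolding H_prod by auto
  moreover have "H `` {a} = R2 `` Range F" if "a \<in> Domain F" for a
    using that unfolding H_prod by auto
  ultimately show "c1 * card (Domain F) powr \<alpha> = card (R1 `` Domain F) \<and>
      (\<forall>a\<in>Domain F. c2 * card (F `` {a}) powr \<alpha> = card (R2 `` (F `` {a})) \<and>
         R2 `` (F `` {a}) = R2 `` Range F)"
    using eq1[OF b] eq2 H_Image by simp
qed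

section \<open>The one-dimensional theorem\<close>

text \<open>A relation instead of a function on families, so that shadows are images and several
  coordinates are handled by products of relations.\<close>

definition drop_one :: "('a set \<times> 'a set) set" where
  "drop_one = {(S, T). \<exists>e\<in>S. T = S - {e}}"

text \<open>For a \<open>k\<close>-uniform \<open>G\<close> these are the complete
  \<open>k\<close>-uniform hypergraphs on \<open>Suc k\<close> vertices inside \<open>G\<close>; for
  \<open>k = 2\<close>, the triangles of a graph.\<close>

definition cliques :: "nat \<Rightarrow> 'a set set \<Rightarrow> 'a set set" where
  "cliques k G = {S. finite S \<and> card S = Suc k \<and> (\<forall>e\<in>S. S - {e} \<in> G)}"

text \<open>As \<open>k > 0\<close>, a clique has a second vertex besides any given
  \<open>v\<close>; removing that one leaves a member of \<open>G\<close> containing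
  \<open>v\<close>.\<close>

lemma cliques_subset_nsets:
  assumes "0 < k"
  shows "cliques k G \<subseteq> nsets (\<Union>G) (Suc k)"
proof
  fix S assume S: "S \<in> cliques k G"
  have "v \<in> \<Union>G" if "v \<in> S" for v
  proof -
    have "card (S - {v}) = k"
      using S that by (simp add: cliques_def)
    with assms obtain e where "e \<in> S - {v}"
      by (metis card.empty ex_in_conv less_irrefl)
    then show ?thesis
      using S that by (intro UnionI[of "S - {e}"]) (auto simp: cliques_def)
  qed
  then show "S \<in> nsets (\<Union>G) (Suc k)"
    using S by (auto simp: cliques_def nsets_def)
qed

lemma sum_degrees_eq:
  assumes "finite V" "F \<subseteq> nsets V k"
  shows "(\<Sum>v\<in>V. card {S \<in> F. v \<in> S}) = k * card F"
proof (rule sum_multicount[OF assms(1)])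
  show "finite F"
    using assms finite_imp_finite_nsets finite_subset by blast
  show "\<forall>S\<in>F. card {v \<in> V. v \<in> S} = k"
  proof
    fix S assume "S \<in> F"
    then have "{v \<in> V. v \<in> S} = S" "card S = k"
      using assms by (auto simp: nsets_def)
    then show "card {v \<in> V. v \<in> S} = k" by simp
  qed
qed

text \<open>The inverse form of the shadow bound, by induction on \<open>k\<close> through vertex
  links. Cliques at \<open>v\<close> are bounded by a multiple of the degree of \<open>v\<close>,
  and summing over all vertices counts every member of \<open>G\<close> and every clique with fixed
  multiplicity. Equality makes all degrees equal to \<open>k * card G / x\<close>, which forces
  \<open>x\<close> to be the number of vertices.\<close>

lemma card_cliques_le:
  fixes x :: real
  assumes "1 \<le> k" "finite G" "G \<subseteq> nsets UNIV k" "real (card G) = x gchoose k" "real k \<le> x"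
  shows "real (card (cliques k G)) \<le> x gchoose Suc k \<and>
    (real (card (cliques k G)) = x gchoose Suc k \<longrightarrow> (\<exists>Y. finite Y \<and> G = nsets Y k))"
  using assms
proof (induction k arbitrary: G x rule: nat_induct_at_least)
  case base
  define Y where "Y = \<Union>G"
  have G: "G = nsets Y 1"
    using base(2) by (auto simp: Y_def nsets_def card_1_singleton_iff)
  then have fin: "finite Y"
    using base(1) by (metis finite_nsets_iff zero_less_one)
  have "card Y = card G"
    by (simp add: G card_nsets)
  then have x: "x = real (card Y)"
    using base(3) by simp
  have "card (cliques 1 G) \<le> card (nsets Y (Suc 1))"
    unfolding Y_def
    by (intro card_mono cliques_subset_nsets) (use fin Y_def in \<open>auto simp: finite_imp_finite_nsets\<close>)
  also have "real \<dots> = x gchoose Suc 1"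
    by (simp add: card_nsets x binomial_gbinomial)
  finally show ?case
    using G fin by auto
next
  case (Suc k)
  define m where "m = Suc k"
  define V where "V = \<Union>G"
  define C where "C = cliques m G"
  define deg where "deg = (\<lambda>v. card {S \<in> G. v \<in> S})"
  define cdeg where "cdeg = (\<lambda>v. card {S \<in> C. v \<in> S})"
  have GV: "G \<subseteq> nsets V m"
    using Suc.prems by (auto simp: V_def nsets_def m_def)
  have finV: "finite V"
    using Suc.prems by (auto simp: V_def nsets_def)
  have CV: "C \<subseteq> nsets V (Suc m)"
    unfolding C_def V_def by (rule cliques_subset_nsets) (simp add: m_def)
  have finC: "finite C"
    using CV finV finite_imp_finite_nsets finite_subset by blast
  have xm: "real m \<le> x" "real (card G) = x gchoose m"
    using Suc.prems by (auto simp: m_def)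
  have link: "real m * cdeg v \<le> (x - m) * deg v"
    and link_strict: "x * deg v \<noteq> real m * card G \<Longrightarrow> real m * cdeg v < (x - m) * deg v"
    if v: "v \<in> V" for v
  proof -
    \<comment> \<open>The link of \<open>v\<close>. Removing \<open>v\<close> from a clique through
      \<open>v\<close> gives a clique of \<open>L\<close>, so the induction hypothesis applies with
      \<open>y\<close> determined by the degree of \<open>v\<close>.\<close>
    define L where "L = {T. v \<notin> T \<and> insert v T \<in> G}"
    have degL: "deg v = card L"
      unfolding deg_def L_def
      by (rule bij_betw_same_card[of "\<lambda>S. S - {v}"], rule bij_betwI[of _ _ _ "insert v"])
        (auto simp: insert_absorb)
    have finL: "finite L"
    proof (rule finite_subset)
      show "L \<subseteq> Pow V"
        by (auto simp: L_def V_def)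
    qed (use finV in simp)
    have Lk: "L \<subseteq> nsets UNIV k"
      using GV by (auto simp: L_def nsets_def m_def)
    have inj: "inj_on (\<lambda>S. S - {v}) {S \<in> C. v \<in> S}"
      by (rule inj_onI) (metis (mono_tags, lifting) insert_Diff mem_Collect_eq)
    have "deg v \<noteq> 0"
      using v Suc.prems by (auto simp: deg_def V_def)
    then obtain y where y: "real k \<le> y" "y gchoose k = real (deg v)"
      using gbinomial_eq_of_nat_ex[of k "deg v"] Suc.hyps by auto
    have "cdeg v \<le> card (cliques k L)"
      unfolding cdeg_def
    proof (rule card_inj_on_le[OF inj])
      show "(\<lambda>S. S - {v}) ` {S \<in> C. v \<in> S} \<subseteq> cliques k L"
      proof clarsimp
        fix S assume S: "S \<in> C" "v \<in> S"
        have "insert v (S - {v} - {e}) \<in> G" if "e \<in> S - {v}" for e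
        proof -
          have "insert v (S - {v} - {e}) = S - {e}"
            using S that by auto
          then show ?thesis
            using S that by (simp add: C_def cliques_def)
        qed
        then show "S - {v} \<in> cliques k L"
          using S by (auto simp: C_def cliques_def L_def m_def)
      qed
      show "finite (cliques k L)"
        using cliques_subset_nsets[of k L] Suc.hyps finL Lk
        by (intro finite_subset[OF cliques_subset_nsets] finite_imp_finite_nsets)
          (auto simp: nsets_def)
    qed
    also have "real \<dots> \<le> y gchoose Suc k"
      using Suc.IH[OF finL Lk, of y] y degL by auto
    finally have "real m * cdeg v \<le> real (Suc k) * (y gchoose Suc k)"
      unfolding m_def by (intro mult_left_mono) auto
    also have "\<dots> = (y - real k) * deg v"
      using gbinomial_mult_1[of y k] y by (simp add: algebra_simps)
    finally have le1: "real m * cdeg v \<le> (y - real k) * deg v" .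
    \<comment> \<open>A second bound, better at large degree: a clique through \<open>v\<close> is
      determined by its member of \<open>G\<close> that avoids \<open>v\<close>.\<close>
    have "cdeg v \<le> card {S \<in> G. v \<notin> S}"
      unfolding cdeg_def
      by (rule card_inj_on_le[OF inj]) (use Suc.prems in \<open>auto simp: C_def cliques_def\<close>)
    moreover have "card G = deg v + card {S \<in> G. v \<notin> S}"
      unfolding deg_def
      by (subst card_Un_disjoint[symmetric]) (use Suc.prems in \<open>auto intro!: arg_cong[of _ _ card]\<close>)
    ultimately have "real (cdeg v) \<le> real (card G) - real (deg v)"
      by linarith
    then have le2: "real m * cdeg v \<le> real m * card G - real m * deg v"
      using mult_left_mono[of "real (cdeg v)" "real (card G) - real (deg v)" "real m"]
      by (simp add: algebra_simps)
    show "real m * cdeg v \<le> (x - m) * deg v"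
      and "x * deg v \<noteq> real m * card G \<Longrightarrow> real m * cdeg v < (x - m) * deg v"
    \<comment> \<open>For small degree the link bound \<open>le1\<close> wins strictly, as
      \<open>y - k < x - m\<close>. Otherwise the degree is at least
      \<open>(x - 1) gchoose k\<close>, hence \<open>m * card G \<le> x * deg v\<close>, and
      \<open>le2\<close> suffices, with equality only if these two agree.\<close>
    proof (atomize(full), cases "y + 1 < x")
      case True
      then have "(y - real k) * deg v < (x - m) * deg v"
        using \<open>deg v \<noteq> 0\<close> by (intro mult_strict_right_mono) (auto simp: m_def)
      with le1 show "real m * cdeg v \<le> (x - m) * deg v \<and>
          (x * deg v \<noteq> real m * card G \<longrightarrow> real m * cdeg v < (x - m) * deg v)"
        by linarith
    next
      case False
      then have "(x - 1) gchoose k \<le> deg v"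
        unfolding y(2)[symmetric] using Suc.hyps xm by (subst gbinomial_le_iff) (auto simp: m_def)
      then have "x * ((x - 1) gchoose k) \<le> x * deg v"
        using xm by (intro mult_left_mono) auto
      moreover have "x * ((x - 1) gchoose k) = real m * card G"
        unfolding xm(2) m_def by (simp only: gbinomial_absorption)
      ultimately show "real m * cdeg v \<le> (x - m) * deg v \<and>
          (x * deg v \<noteq> real m * card G \<longrightarrow> real m * cdeg v < (x - m) * deg v)"
        using le2 by (auto simp: algebra_simps)
    qed
  qed
  have sum_deg: "(\<Sum>v\<in>V. (x - m) * deg v) = (x - m) * (m * card G)"
    unfolding sum_distrib_left[symmetric] deg_def using sum_degrees_eq[OF finV GV]
    by (simp flip: of_nat_sum)
  have sum_cdeg: "(\<Sum>v\<in>V. real m * cdeg v) = real m * (Suc m * card C)"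
    unfolding sum_distrib_left[symmetric] cdeg_def using sum_degrees_eq[OF finV CV]
    by (simp flip: of_nat_sum)
  have rhs: "(x - m) * (m * card G) = real m * (Suc m * (x gchoose Suc m))"
    using gbinomial_mult_1[of x m] xm(2) by (simp add: algebra_simps)
  have "(\<Sum>v\<in>V. real m * cdeg v) \<le> (\<Sum>v\<in>V. (x - m) * deg v)"
    by (intro sum_mono link)
  then have "(real m * Suc m) * card C \<le> (real m * Suc m) * (x gchoose Suc m)"
    unfolding sum_deg sum_cdeg rhs by (simp only: mult.assoc of_nat_mult)
  then have bound: "real (card C) \<le> x gchoose Suc m"
    by (rule mult_left_le_imp_le) (simp add: m_def)
  have "\<exists>Y. finite Y \<and> G = nsets Y m" if eq: "real (card C) = x gchoose Suc m"
  proof -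
    have "x * deg v = real m * card G" if "v \<in> V" for v
    proof (rule ccontr)
      assume "x * deg v \<noteq> real m * card G"
      then have "(\<Sum>v\<in>V. real m * cdeg v) < (\<Sum>v\<in>V. (x - m) * deg v)"
        using finV link link_strict that by (intro sum_strict_mono_ex1) blast+
      then show False
        unfolding sum_deg sum_cdeg rhs unfolding of_nat_mult eq by simp
    qed
    then have "(\<Sum>v\<in>V. x * deg v) = card V * (real m * card G)"
      by simp
    moreover have "(\<Sum>v\<in>V. x * deg v) = x * (real m * card G)"
      unfolding sum_distrib_left[symmetric] deg_def using sum_degrees_eq[OF finV GV]
      by (simp flip: of_nat_sum)
    moreover have "card G \<noteq> 0"
      using xm gbinomial_pos[of m x] by auto
    \<comment> \<open>The sum of \<open>x * deg v\<close> has been computed twice, from the constant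
      value and from the degree sum; the nonzero factor \<open>m * card G\<close> cancels.\<close>
    ultimately have "x = card V"
      by (simp add: m_def)
    then have "card G = card (nsets V m)"
      using xm(2) by (simp add: card_nsets flip: binomial_gbinomial)
    then have "G = nsets V m"
      using GV finV by (intro card_subset_eq finite_imp_finite_nsets)
    with finV show ?thesis by blast
  qed
  with bound show ?case
    unfolding C_def m_def by blast
qed

text \<open>Every member of \<open>F\<close> is a clique of its shadow \<open>G\<close>. Writing
  \<open>card G\<close> as \<open>y gchoose k\<close>, the clique bound gives
  \<open>x gchoose Suc k \<le> y gchoose Suc k\<close>, hence \<open>x \<le> y\<close>. Equality
  makes \<open>G\<close> complete and \<open>F\<close> the family of all its cliques.\<close>

lemma kruskal_katona_lovasz:
  fixes x :: real
  assumes "0 < k" "finite F" "F \<subseteq> nsets UNIV (Suc k)"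
    "real (card F) = x gchoose Suc k" "real (Suc k) \<le> x"
  shows "x gchoose k \<le> real (card (drop_one `` F)) \<and>
    (real (card (drop_one `` F)) = x gchoose k \<longrightarrow> (\<exists>Y. F = nsets Y (Suc k)))"
proof -
  define G where "G = drop_one `` F"
  have G_eq: "G = (\<Union>S\<in>F. (\<lambda>e. S - {e}) ` S)"
    by (auto simp: G_def drop_one_def)
  have finG: "finite G"
    unfolding G_eq using assms by (auto simp: nsets_def)
  have Gk: "G \<subseteq> nsets UNIV k"
    unfolding G_eq using assms(3) by (fastforce simp: nsets_def)
  have Fsub: "F \<subseteq> cliques k G"
    using assms(3) by (auto simp: cliques_def G_eq nsets_def)
  have finC: "finite (cliques k G)"
    using finG Gk assms(1)
    by (intro finite_subset[OF cliques_subset_nsets] finite_imp_finite_nsets) (auto simp: nsets_def)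
  have "card F \<noteq> 0"
    using assms gbinomial_pos[of "Suc k" x] by auto
  then obtain S where S: "S \<in> F"
    by fastforce
  then obtain e where "e \<in> S"
    using assms(3) by (fastforce simp: nsets_def)
  with S have "G \<noteq> {}"
    by (auto simp: G_eq)
  then obtain y where y: "real k \<le> y" "y gchoose k = real (card G)"
    using gbinomial_eq_of_nat_ex[of k "card G"] assms(1) finG by (auto simp: card_gt_0_iff)
  have cl: "real (card (cliques k G)) \<le> y gchoose Suc k"
    "real (card (cliques k G)) = y gchoose Suc k \<Longrightarrow> \<exists>Y. finite Y \<and> G = nsets Y k"
    using card_cliques_le[OF _ finG Gk y(2)[symmetric] y(1)] assms(1) by auto
  have FC: "card F \<le> card (cliques k G)"
    by (rule card_mono[OF finC Fsub])
  then have le: "x gchoose Suc k \<le> y gchoose Suc k"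
    using cl(1) assms(4) by linarith
  \<comment> \<open>At \<open>y = k\<close> this coefficient vanishes; excluding that value puts
    \<open>y\<close> in the range where the coefficient is monotone.\<close>
  have "0 < y gchoose Suc k"
    using le assms gbinomial_pos[of "Suc k" x] by linarith
  then have "y \<noteq> real k"
    by (auto simp: binomial_gbinomial[symmetric])
  then have "x \<le> y"
    using le gbinomial_le_iff[of "Suc k" x y] assms y(1) by auto
  then have "x gchoose k \<le> y gchoose k"
    using gbinomial_le_iff[of k x y] assms by auto
  moreover have "\<exists>Y. F = nsets Y (Suc k)" if eq: "real (card G) = x gchoose k"
  proof -
    have "y gchoose k \<le> x gchoose k"
      using eq y by simp
    then have "x = y"
      using \<open>x \<le> y\<close> gbinomial_le_iff[of k y x] assms by auto
    then have "real (card (cliques k G)) = y gchoose Suc k"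
      using cl(1) FC assms(4) unfolding \<open>x = y\<close> by linarith
    then obtain Y where Y: "finite Y" "G = nsets Y k"
      using cl(2) by blast
    have "card F = card (cliques k G)"
      using \<open>real (card (cliques k G)) = y gchoose Suc k\<close> assms(4)
      unfolding \<open>x = y\<close> by linarith
    then have "F = cliques k G"
      using finC Fsub by (simp add: card_subset_eq)
    also have "\<dots> = nsets Y (Suc k)"
    proof
      have "\<Union>G \<subseteq> Y"
        by (auto simp: Y nsets_def)
      then show "cliques k G \<subseteq> nsets Y (Suc k)"
        using cliques_subset_nsets[OF assms(1), of G] nsets_mono[of "\<Union>G" Y "Suc k"] by blast
      show "nsets Y (Suc k) \<subseteq> cliques k G"
        by (auto simp: Y(2) cliques_def nsets_def)
    qed
    finally show ?thesis by blast
  qed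
  ultimately show ?thesis
    using y(2) by (auto simp: G_def)
qed

text \<open>The constants depend on \<open>x\<close> and \<open>k\<close> only, while the power
  bound holds for families of every size. This uniformity is what tensorisation needs, since fibres
  of a family may have any size. The shape in the equality case is inherited from
  \<open>kruskal_katona_lovasz\<close>.\<close>

lemma kruskal_katona_tangent:
  fixes x :: real
  assumes k: "0 < k" and x: "real (Suc k) \<le> x"
  obtains c \<alpha> where "0 < c" "0 < \<alpha>" "\<alpha> < 1" "c * (x gchoose Suc k) powr \<alpha> = x gchoose k"
    "\<And>F :: 'a set set. F \<subseteq> nsets UNIV (Suc k) \<Longrightarrow> F \<noteq> {} \<Longrightarrow> finite F \<Longrightarrow>
      c * card F powr \<alpha> \<le> card (drop_one `` F)"
    "\<And>F :: 'a set set. F \<subseteq> nsets UNIV (Suc k) \<Longrightarrow> F \<noteq> {} \<Longrightarrow> finite F \<Longrightarrow>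
      c * card F powr \<alpha> = card (drop_one `` F) \<Longrightarrow> \<exists>Y. F = nsets Y (Suc k)"
proof -
  obtain \<alpha> where \<alpha>: "0 < \<alpha>" "\<alpha> < 1"
    and tangent: "\<And>y. real k < y \<Longrightarrow> y \<noteq> x \<Longrightarrow>
      ln (x gchoose k) - \<alpha> * ln (x gchoose Suc k) < ln (y gchoose k) - \<alpha> * ln (y gchoose Suc k)"
    using gbinomial_log_tangent[of k x] k x by auto
  \<comment> \<open>Normalised so that the power bound touches the binomial curve at
    \<open>x\<close>.\<close>
  define c where "c = (x gchoose k) / (x gchoose Suc k) powr \<alpha>"
  have pos: "0 < y gchoose k" "0 < y gchoose Suc k" if "real k < y" for y
    using that gbinomial_pos[of k y] gbinomial_pos[of "Suc k" y] by auto
  have c: "0 < c"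
    using pos[of x] x by (simp add: c_def)
  have less: "c * (y gchoose Suc k) powr \<alpha> < y gchoose k" if "real k < y" "y \<noteq> x" for y
  proof -
    have "ln (c * (y gchoose Suc k) powr \<alpha>) = ln (x gchoose k) - \<alpha> * ln (x gchoose Suc k)
        + \<alpha> * ln (y gchoose Suc k)"
      using pos[of x] pos[OF that(1)] x c by (simp add: ln_mult ln_divide_pos ln_powr c_def)
    also have "\<dots> < ln (y gchoose k)"
      using tangent[OF that] by simp
    finally show ?thesis
      using pos[OF that(1)] c by simp
  qed
  have eq: "c * (x gchoose Suc k) powr \<alpha> = x gchoose k"
    using pos(2)[of x] x by (simp add: c_def)
  have main: "c * card F powr \<alpha> \<le> card (drop_one `` F) \<and>
      (c * card F powr \<alpha> = card (drop_one `` F) \<longrightarrow> (\<exists>Y. F = nsets Y (Suc k)))"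
    if F: "F \<subseteq> nsets UNIV (Suc k)" "F \<noteq> {}" "finite F" for F :: "'a set set"
  proof -
    obtain y where y: "real (Suc k) \<le> y" "y gchoose Suc k = real (card F)"
      using gbinomial_eq_of_nat_ex[of "Suc k" "card F"] F by (auto simp: card_gt_0_iff)
    have "c * (y gchoose Suc k) powr \<alpha> \<le> y gchoose k"
      using less[of y] eq y by (cases "y = x") auto
    then show ?thesis
      using kruskal_katona_lovasz[OF k F(3,1) y(2)[symmetric] y(1)] y(2) by auto
  qed
  show ?thesis
    using that[OF c \<alpha> eq] main by blast
qed

section \<open>Tuples\<close>

text \<open>The index set is arbitrary so that coordinates can be added one at a time;
  \<open>extensional\<close> fixes the values of \<open>T\<close> outside \<open>I\<close>.\<close>

definition drop_one_each :: "'i set \<Rightarrow> (('i \<Rightarrow> 'a set) \<times> ('i \<Rightarrow> 'a set)) set" where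
  "drop_one_each I = {(S, T). T \<in> extensional I \<and> (\<forall>i\<in>I. (S i, T i) \<in> drop_one)}"

lemma shadow_eq_Image: "shadow d F = drop_one_each {1..d} `` F"
proof
  show "shadow d F \<subseteq> drop_one_each {1..d} `` F"
    by (force simp: shadow_def drop_one_each_def drop_one_def)
  show "drop_one_each {1..d} `` F \<subseteq> shadow d F"
  proof
    fix T assume "T \<in> drop_one_each {1..d} `` F"
    then obtain S where T: "(S, T) \<in> drop_one_each {1..d}" and S: "S \<in> F"
      by blast
    then obtain e where e: "\<forall>i\<in>{1..d}. e i \<in> S i \<and> T i = S i - {e i}"
      unfolding drop_one_each_def drop_one_def by (auto simp: Ball_def) metis
    have "T = (\<lambda>i\<in>{1..d}. S i - {e i})"
      using T e by (intro extensionalityI[of _ "{1..d}"]) (auto simp: drop_one_each_def)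
    then show "T \<in> shadow d F"
      using S e by (auto simp: shadow_def)
  qed
qed

text \<open>A tuple on \<open>insert i J\<close> is encoded as a tuple on \<open>J\<close> together
  with its entry at \<open>i\<close>. Under this encoding the shadow is a product of relations, to
  which \<open>card_rel_times_Image_ge\<close> applies.\<close>

lemma drop_one_each_insert:
  assumes "i \<notin> J"
  shows "drop_one_each (insert i J) `` ((\<lambda>(a, S). a(i := S)) ` F) =
    (\<lambda>(a, S). a(i := S)) ` (rel_times (drop_one_each J) drop_one `` F)"
proof
  show "(\<lambda>(a, S). a(i := S)) ` (rel_times (drop_one_each J) drop_one `` F)
    \<subseteq> drop_one_each (insert i J) `` ((\<lambda>(a, S). a(i := S)) ` F)"
  proof
    fix U assume "U \<in> (\<lambda>(a, S). a(i := S)) ` (rel_times (drop_one_each J) drop_one `` F)"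
    then obtain a S b T where aS: "(a, S) \<in> F" and b: "(a, b) \<in> drop_one_each J"
      and T: "(S, T) \<in> drop_one" and U: "U = b(i := T)"
      by (auto simp: rel_times_def)
    have "(a(i := S), U) \<in> drop_one_each (insert i J)"
      using b T assms unfolding U by (auto simp: drop_one_each_def extensional_def)
    then show "U \<in> drop_one_each (insert i J) `` ((\<lambda>(a, S). a(i := S)) ` F)"
      using aS by (intro ImageI[of "a(i := S)"]) force+
  qed
  show "drop_one_each (insert i J) `` ((\<lambda>(a, S). a(i := S)) ` F)
    \<subseteq> (\<lambda>(a, S). a(i := S)) ` (rel_times (drop_one_each J) drop_one `` F)"
  proof
    fix T assume "T \<in> drop_one_each (insert i J) `` ((\<lambda>(a, S). a(i := S)) ` F)"
    then obtain a S where aS: "(a, S) \<in> F" and T: "(a(i := S), T) \<in> drop_one_each (insert i J)"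
      by auto
    define b where "b = restrict T J"
    have "T = b(i := T i)"
      using T by (auto simp: b_def drop_one_each_def extensional_def fun_eq_iff)
    moreover have "(a, b) \<in> drop_one_each J" "(S, T i) \<in> drop_one"
      using T assms by (auto simp: drop_one_each_def b_def split: if_splits)
    then have "(b, T i) \<in> rel_times (drop_one_each J) drop_one `` F"
      using aS by (auto simp: rel_times_def)
    ultimately show "T \<in> (\<lambda>(a, S). a(i := S)) ` (rel_times (drop_one_each J) drop_one `` F)"
      by (metis (no_types, lifting) case_prod_conv image_eqI)
  qed
qed

text \<open>The value overwritten at \<open>i\<close> is always \<open>undefined\<close>, as
  \<open>i\<close> is outside \<open>J\<close>, so nothing is lost and cardinalities carry
  over.\<close>

lemma inj_on_fun_upd_extensional:
  assumes "i \<notin> J"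
  shows "inj_on (\<lambda>(a, S). a(i := S)) (extensional J \<times> UNIV)"
proof (rule inj_onI, clarsimp)
  fix a b S T assume a: "a \<in> extensional J" "b \<in> extensional J" and eq: "a(i := S) = b(i := T)"
  have "S = T"
    using fun_cong[OF eq, of i] by simp
  moreover have "a = b"
  proof
    fix j show "a j = b j"
      using fun_cong[OF eq, of j] a assms by (cases "j = i") (auto simp: extensional_def)
  qed
  ultimately show "a = b \<and> S = T" by simp
qed

text \<open>Recovers the ground set from the shadow. In the equality case this shows that complete
  fibres with the same shadow coincide.\<close>

lemma Union_drop_one_nsets:
  assumes "0 < k" "nsets Y (Suc k) \<noteq> {}"
  shows "\<Union>(drop_one `` nsets Y (Suc k)) = Y"
proof
  show "\<Union>(drop_one `` nsets Y (Suc k)) \<subseteq> Y"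
    by (auto simp: drop_one_def nsets_def)
  show "Y \<subseteq> \<Union>(drop_one `` nsets Y (Suc k))"
  proof
    fix v assume v: "v \<in> Y"
    obtain S where S: "S \<subseteq> Y" "finite S" "card S = Suc k"
      using assms(2) by (auto simp: nsets_def)
    \<comment> \<open>An exchange puts \<open>v\<close> into a set of the right size; since
      \<open>k > 0\<close>, an element other than \<open>v\<close> can then be removed.\<close>
    obtain T where T: "T \<subseteq> Y" "finite T" "card T = Suc k" "v \<in> T"
    proof (cases "v \<in> S")
      case False
      obtain u where "u \<in> S"
        using S by fastforce
      with S v False show ?thesis
        by (intro that[of "insert v (S - {u})"]) auto
    qed (use S that in blast)
    have "card (T - {v}) = k"
      using T by simp
    then obtain e where "e \<in> T - {v}"
      using assms(1) by (metis card.empty ex_in_conv less_irrefl)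
    with T show "v \<in> \<Union>(drop_one `` nsets Y (Suc k))"
      by (intro UnionI[of "T - {e}"] ImageI[of T]) (auto simp: drop_one_def nsets_def)
  qed
qed

lemma finite_drop_one_each:
  assumes "finite I" "\<And>i. i \<in> I \<Longrightarrow> finite (S i)"
  shows "finite (drop_one_each I `` {S})"
proof (rule finite_subset)
  show "drop_one_each I `` {S} \<subseteq> (\<Pi>\<^sub>E i\<in>I. Pow (S i))"
    by (auto simp: drop_one_each_def drop_one_def PiE_def)
  show "finite (\<Pi>\<^sub>E i\<in>I. Pow (S i))"
    using assms by (intro finite_PiE) auto
qed

text \<open>Induction on the coordinates with \<open>c\<close> and \<open>\<alpha>\<close> fixed:
  each new coordinate contributes one factor \<open>c\<close> and leaves the exponent
  unchanged.\<close>

lemma card_drop_one_each_ge: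
  fixes X :: "'a set" and F :: "('i \<Rightarrow> 'a set) set"
  assumes "finite I" and X: "finite X" and k: "0 < k" and c: "0 < c" and \<alpha>: "0 < \<alpha>" "\<alpha> < 1"
    and one: "\<And>G :: 'a set set. G \<subseteq> nsets UNIV (Suc k) \<Longrightarrow> G \<noteq> {} \<Longrightarrow> finite G \<Longrightarrow>
      c * card G powr \<alpha> \<le> card (drop_one `` G)"
    and one_eq: "\<And>G :: 'a set set. G \<subseteq> nsets UNIV (Suc k) \<Longrightarrow> G \<noteq> {} \<Longrightarrow> finite G \<Longrightarrow>
      c * card G powr \<alpha> = card (drop_one `` G) \<Longrightarrow> \<exists>Y. G = nsets Y (Suc k)"
    and "F \<subseteq> (\<Pi>\<^sub>E i\<in>I. nsets X (Suc k))" "F \<noteq> {}"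
  shows "c ^ card I * card F powr \<alpha> \<le> card (drop_one_each I `` F) \<and>
    (c ^ card I * card F powr \<alpha> = card (drop_one_each I `` F) \<longrightarrow>
      (\<exists>Y. F = (\<Pi>\<^sub>E i\<in>I. nsets (Y i) (Suc k))))"
  using assms(1,9,10)
proof (induction I arbitrary: F rule: finite_induct)
  case empty
  then have F: "F = {\<lambda>_. undefined}"
    by auto
  have "drop_one_each {} `` F = {\<lambda>_. undefined}"
    unfolding F by (auto simp: drop_one_each_def)
  then show ?case
    unfolding F by simp
next
  case (insert i J)
  define P where "P = (\<Pi>\<^sub>E j\<in>J. nsets X (Suc k))"
  define N where "N = nsets X (Suc k)"
  define \<phi> :: "('i \<Rightarrow> 'a set) \<times> 'a set \<Rightarrow> ('i \<Rightarrow> 'a set)" where "\<phi> = (\<lambda>(a, S). a(i := S))"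
  \<comment> \<open>\<open>F\<close> with the coordinate \<open>i\<close> split off, as a relation
    between tuples on \<open>J\<close> and single sets.\<close>
  define F' where "F' = {aS \<in> P \<times> N. \<phi> aS \<in> F}"
  have "(\<Pi>\<^sub>E j\<in>insert i J. nsets X (Suc k)) = \<phi> ` (P \<times> N)"
    unfolding P_def N_def \<phi>_def PiE_insert_eq by (force simp: image_iff)
  then have FF': "F = \<phi> ` F'"
    using insert.prems(1) by (auto simp: F'_def)
  have F'_sub: "F' \<subseteq> P \<times> N"
    by (auto simp: F'_def)
  have finP: "finite P" and finN: "finite N"
    unfolding P_def N_def using insert.hyps X by (auto intro!: finite_PiE finite_imp_finite_nsets)
  have finF': "finite F'"
    using F'_sub finP finN finite_subset by blast
  have P_ext: "P \<subseteq> extensional J"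
    by (auto simp: P_def PiE_def)
  have inj: "inj_on \<phi> (extensional J \<times> UNIV)"
    unfolding \<phi>_def using insert.hyps by (intro inj_on_fun_upd_extensional)
  have card_F: "card F = card F'"
    unfolding FF' using inj F'_sub P_ext by (intro card_image inj_on_subset[OF inj]) auto
  have F'_ne: "F' \<noteq> {}"
    using insert.prems(2) FF' by auto
  let ?R = "rel_times (drop_one_each J) drop_one"
  have "drop_one_each (insert i J) `` F = \<phi> ` (?R `` F')"
    unfolding FF' \<phi>_def using insert.hyps by (intro drop_one_each_insert)
  moreover have "?R `` F' \<subseteq> extensional J \<times> UNIV"
    by (auto simp: rel_times_def drop_one_each_def)
  ultimately have card_shadow: "card (drop_one_each (insert i J) `` F) = card (?R `` F')"
    using inj by (metis card_image inj_on_subset)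
  have fin1: "finite (drop_one_each J `` {a})" if "a \<in> P" for a
    using that insert.hyps by (intro finite_drop_one_each) (auto simp: P_def nsets_def PiE_def Pi_def)
  have fin2: "finite (drop_one `` {S :: 'a set})" if "S \<in> N" for S
  proof -
    have "drop_one `` {S} = (\<lambda>e. S - {e}) ` S"
      by (auto simp: drop_one_def)
    then show ?thesis
      using that by (simp add: N_def nsets_def)
  qed
  have N_UNIV: "N \<subseteq> nsets UNIV (Suc k)"
    unfolding N_def by (intro nsets_mono) simp
  have IH1: "c ^ card J * card S powr \<alpha> \<le> card (drop_one_each J `` S)"
    if "S \<subseteq> P" "S \<noteq> {}" for S
    using insert.IH[of S] that by (auto simp: P_def)
  have IH2: "c * card S powr \<alpha> \<le> card (drop_one `` S)"
    if "S \<subseteq> N" "S \<noteq> {}" "finite S" for S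
    using one[of S] that N_UNIV by blast
  note tensor = card_rel_times_Image_ge[OF \<alpha> zero_less_power[OF c] c finF' fin1 fin2 F'_sub F'_ne IH1 IH2]
  have pow: "c ^ card (insert i J) = c ^ card J * c"
    using insert.hyps by simp
  have "c ^ card (insert i J) * card F powr \<alpha> \<le> card (drop_one_each (insert i J) `` F)"
    unfolding card_shadow card_F pow by (rule tensor(1))
  moreover have "\<exists>Y. F = (\<Pi>\<^sub>E i\<in>insert i J. nsets (Y i) (Suc k))"
    if "c ^ card (insert i J) * card F powr \<alpha> = card (drop_one_each (insert i J) `` F)"
  proof -
    have eq1: "c ^ card J * card (Domain F') powr \<alpha> = card (drop_one_each J `` Domain F')"
      and eq2: "\<And>a. a \<in> Domain F' \<Longrightarrow> c * card (F' `` {a}) powr \<alpha> = card (drop_one `` (F' `` {a}))"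
      and eq3: "\<And>a. a \<in> Domain F' \<Longrightarrow> drop_one `` (F' `` {a}) = drop_one `` Range F'"
      using tensor(2) that unfolding card_shadow card_F pow by blast+
    have "Domain F' \<subseteq> P" "Domain F' \<noteq> {}"
      using F'_sub F'_ne by auto
    then obtain Y where Y: "Domain F' = (\<Pi>\<^sub>E i\<in>J. nsets (Y i) (Suc k))"
      using insert.IH[of "Domain F'"] eq1 unfolding P_def by blast
    \<comment> \<open>By \<open>eq3\<close> all fibres have the same shadow. Each fibre is complete
      by \<open>one_eq\<close>, and its ground set is the union of that shadow, so \<open>Z\<close>
      serves for every fibre.\<close>
    define Z where "Z = \<Union>(drop_one `` Range F')"
    have fiber: "F' `` {a} = nsets Z (Suc k)" if a: "a \<in> Domain F'" for a
    proof -
      have ne: "F' `` {a} \<noteq> {}"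
        using a by auto
      have "finite (F' `` {a})"
        using finF' by (meson finite_Image)
      then obtain Z' where Z': "F' `` {a} = nsets Z' (Suc k)"
        using one_eq[of "F' `` {a}"] ne F'_sub N_UNIV eq2[OF a] by blast
      then have "Z' = Z"
        using Union_drop_one_nsets[OF k, of Z'] ne eq3[OF a] by (simp add: Z_def)
      with Z' show ?thesis by simp
    qed
    have "F' = (\<Pi>\<^sub>E i\<in>J. nsets (Y i) (Suc k)) \<times> nsets Z (Suc k)"
    proof -
      have "F' = (SIGMA a:Domain F'. F' `` {a})"
        by auto
      also have "\<dots> = Domain F' \<times> nsets Z (Suc k)"
        using fiber by (intro Sigma_cong) auto
      finally show ?thesis
        unfolding Y .
    qed
    moreover have "(\<Pi>\<^sub>E j\<in>J. nsets (Y j) (Suc k)) = (\<Pi>\<^sub>E j\<in>J. nsets ((Y(i := Z)) j) (Suc k))"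
      using insert.hyps by (intro PiE_cong) auto
    ultimately have "F = (\<Pi>\<^sub>E j\<in>insert i J. nsets ((Y(i := Z)) j) (Suc k))"
      unfolding FF' \<phi>_def PiE_insert_eq by (force simp: image_iff)
    then show ?thesis by blast
  qed
  ultimately show ?case by blast
qed

text \<open>The equality clause is restricted because for \<open>r = 1\<close> the shadow of a
  nonempty family is always the single tuple of empty sets and the bound is 1. Equality then holds
  for every such family, and for \<open>d \<ge> 2\<close> these need not be products: two pairs
  \<open>({a}, {a})\<close> and \<open>({b}, {b})\<close> with distinct \<open>a\<close>,
  \<open>b\<close> form a counterexample.\<close>

theorem theorem1:
  fixes X :: "'a set" and d r :: nat and F :: "(nat \<Rightarrow> 'a set) set" and x :: real
  assumes "finite X" and "d \<ge> 1" and "r \<ge> 1"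
    and "uniform_family d r X F"
    and "real (card F) = (x gchoose r) ^ d"
    and "x \<ge> real r"
  shows "real (card (shadow d F)) \<ge> (x gchoose (r - 1)) ^ d \<and>
    (r \<ge> 2 \<or> d = 1 \<longrightarrow>
      real (card (shadow d F)) = (x gchoose (r - 1)) ^ d \<longrightarrow>
      (\<exists>Y. (\<forall>i\<in>{1..d}. Y i \<subseteq> X) \<and> F = (\<Pi>\<^sub>E i\<in>{1..d}. nsets (Y i) r)))"
proof -
  have F: "F \<subseteq> (\<Pi>\<^sub>E i\<in>{1..d}. nsets X r)"
    using assms(4) by (simp add: uniform_family_def)
  have pos: "0 < x gchoose r"
    using assms(6) by (intro gbinomial_pos) simp
  then have "0 < real (card F)"
    unfolding assms(5) by (rule zero_less_power)
  then have F_ne: "F \<noteq> {}"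
    by auto
  show ?thesis
  \<comment> \<open>The tangent argument requires \<open>r - 1 > 0\<close>. For \<open>r = 1\<close>
    it suffices that the shadow is nonempty.\<close>
  proof (cases "r = 1")
    case True
    obtain S where S: "S \<in> F"
      using F_ne by blast
    have "\<exists>e. e \<in> S i" if "i \<in> {1..d}" for i
      using PiE_mem[OF subsetD[OF F S] that] True by (auto simp: nsets_one)
    then obtain e where "\<forall>i\<in>{1..d}. e i \<in> S i"
      by metis
    then have "(\<lambda>i\<in>{1..d}. S i - {e i}) \<in> shadow d F"
      using S unfolding shadow_def by blast
    then have "shadow d F \<noteq> {}"
      by blast
    moreover have "finite (shadow d F)"
      using uniform_family_shadow[OF assms(4)] unfolding uniform_family_def
      by (rule finite_subset) (auto intro!: finite_PiE finite_imp_finite_nsets assms(1))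
    ultimately have "1 \<le> card (shadow d F)"
      by (simp add: Suc_le_eq card_gt_0_iff)
    moreover have "\<exists>Y. (\<forall>i\<in>{1..d}. Y i \<subseteq> X) \<and> F = (\<Pi>\<^sub>E i\<in>{1..d}. nsets (Y i) r)" if "d = 1"
    proof (intro exI conjI ballI)
      \<comment> \<open>With \<open>d = 1\<close> any family of singletons is complete on the set of
        its points; the only coordinate is 1, so \<open>?Y\<close> is constant in
        \<open>i\<close>.\<close>
      let ?Y = "\<lambda>i::nat. {v. (\<lambda>j\<in>{1}. {v}) \<in> F}"
      show "?Y i \<subseteq> X" for i
        using F by (auto simp: that True nsets_one PiE_iff)
      show "F = (\<Pi>\<^sub>E i\<in>{1..d}. nsets (?Y i) r)"
      proof (intro set_eqI)
        fix S :: "nat \<Rightarrow> 'a set"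
        have rep: "S = (\<lambda>j\<in>{1}. {v})" if "S \<in> extensional {1}" "S 1 = {v}" for v
          using that by (intro extensionalityI[of _ "{1}"]) auto
        show "S \<in> F \<longleftrightarrow> S \<in> (\<Pi>\<^sub>E i\<in>{1..d}. nsets (?Y i) r)"
        proof
          assume S: "S \<in> F"
          then have "S \<in> (\<Pi>\<^sub>E i\<in>{1}. nsets X 1)"
            using F that True by auto
          then obtain v where v: "S \<in> extensional {1}" "S 1 = {v}"
            by (auto simp: nsets_one PiE_iff)
          then have "v \<in> ?Y 1"
            using rep S by auto
          with v show "S \<in> (\<Pi>\<^sub>E i\<in>{1..d}. nsets (?Y i) r)"
            by (simp add: that True nsets_one PiE_iff)
        next
          assume "S \<in> (\<Pi>\<^sub>E i\<in>{1..d}. nsets (?Y i) r)"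
          then show "S \<in> F"
            using rep by (auto simp: that True nsets_one PiE_iff)
        qed
      qed
    qed
    ultimately show ?thesis
      using True by auto
  next
    case False
    define k where "k = r - 1"
    have k: "0 < k" "r = Suc k"
      using False assms(3) by (auto simp: k_def)
    obtain c \<alpha> where c: "0 < c" "0 < \<alpha>" "\<alpha> < 1" and eq: "c * (x gchoose Suc k) powr \<alpha> = x gchoose k"
      and one: "\<And>G :: 'a set set. G \<subseteq> nsets UNIV (Suc k) \<Longrightarrow> G \<noteq> {} \<Longrightarrow> finite G \<Longrightarrow>
        c * card G powr \<alpha> \<le> card (drop_one `` G)"
      and one_eq: "\<And>G :: 'a set set. G \<subseteq> nsets UNIV (Suc k) \<Longrightarrow> G \<noteq> {} \<Longrightarrow> finite G \<Longrightarrow>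
        c * card G powr \<alpha> = card (drop_one `` G) \<Longrightarrow> \<exists>Y. G = nsets Y (Suc k)"
      using kruskal_katona_tangent[of k x] k assms(6) by metis
    \<comment> \<open>The tangent was taken at the given \<open>x\<close>, so the tensorised power
      bound is exact at \<open>card F\<close>.\<close>
    have "c ^ d * card F powr \<alpha> = (c * (x gchoose r) powr \<alpha>) ^ d"
      using pos by (simp add: assms(5) power_mult_distrib powr_powr mult.commute flip: powr_realpow)
    also have "\<dots> = (x gchoose (r - 1)) ^ d"
      using eq k by simp
    finally have bound: "c ^ card {1..d} * card F powr \<alpha> = (x gchoose (r - 1)) ^ d"
      by simp
    have main: "(x gchoose (r - 1)) ^ d \<le> card (shadow d F) \<and>
      ((x gchoose (r - 1)) ^ d = card (shadow d F) \<longrightarrow> (\<exists>Y. F = (\<Pi>\<^sub>E i\<in>{1..d}. nsets (Y i) r)))"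
      using card_drop_one_each_ge[OF finite_atLeastAtMost assms(1) k(1) c one one_eq F[unfolded k(2)] F_ne]
      unfolding bound shadow_eq_Image k(2)[symmetric] by blast
    \<comment> \<open>Nonemptiness of \<open>F\<close> makes each factor nonempty, so every point of
      \<open>Y i\<close> occurs in the shadow of a family of subsets of \<open>X\<close>.\<close>
    moreover have "\<forall>i\<in>{1..d}. Y i \<subseteq> X" if Y: "F = (\<Pi>\<^sub>E i\<in>{1..d}. nsets (Y i) r)" for Y
    proof
      fix i assume i: "i \<in> {1..d}"
      have "nsets (Y i) r \<noteq> {}"
        using F_ne i unfolding Y by (auto simp: PiE_eq_empty_iff)
      moreover have "nsets (Y i) r \<subseteq> nsets X r"
        using F F_ne i unfolding Y by (simp add: subset_PiE)
      ultimately have "Y i \<subseteq> \<Union>(drop_one `` nsets X r)"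
        using Union_drop_one_nsets[OF k(1), of "Y i"] unfolding k(2) by blast
      also have "\<dots> \<subseteq> X"
        by (auto simp: drop_one_def nsets_def)
      finally show "Y i \<subseteq> X" .
    qed
    ultimately show ?thesis
      by (metis order_refl)
  qed
qed

end
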